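(* For every integer $n\ge 1$, $$\mathrm{pf}_n(132,213,312)=\mathrm{pf}_n(213,231,312)=C_{n+1}-C_n,$$ where $C_k=\frac{1}{k+1}\binom{2k}{k}$ is the $k$th Catalan number.
   Context: A Dyck path of semilength $n$ is a lattice path from $(0,0)$ to $(n,n)$ consisting of $n$ north steps $N=(0,1)$ and $n$ east steps $E=(1,0)$ that never goes below the line $y=x$. A parking function of size $n$ is a Dyck path of semilength $n$ whose $n$ north steps are labeled bijectively by $\{1,\dots,n\}$ so that whenever two north steps are consecutive in the path (one immediately following the other), the label of the later one is larger. For a parking function $p$ of size $n$, $\phi(p)$ is the permutation of $\{1,\dots,n\}$ (in one-line notation) obtained by reading the labels of the north steps in the order they occur along the path. A permutation $\pi$ of $\{1,\dots,n\}$ contains a permutation $\rho$ of $\{1,\dots,m\}$ if there are indices $1\le i_1<\cdots<i_m\le n$ such that $\pi_{i_a}\le\pi_{i_b}$ if and only if $\rho_a\le\rho_b$; otherwise $\pi$ avoids $\rho$. For permutations $\rho_1,\dots,\rho_r$, $\mathrm{pf}_n(\rho_1,\dots,\rho_r)$ denotes the number of parking functions $p$ of size $n$ such that $\phi(p)$ avoids each of $\rho_1,\dots,\rho_r$. *)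

theory Defs
  imports Complex_Main "HOL-Combinatorics.Multiset_Permutations"
begin

text \<open>
  Lattice paths are lists of steps. Every north step carries a label; the conditions that make a
  path a Dyck path do not look at the labels.
\<close>

datatype 'a step = is_north: North (label: 'a) | is_east: East

definition height :: "'a step list \<Rightarrow> nat" where
  "height w = length (filter is_north w)"

definition width :: "'a step list \<Rightarrow> nat" where
  "width w = length (filter is_east w)"

definition dyck_path :: "nat \<Rightarrow> 'a step list \<Rightarrow> bool" where
  "dyck_path n w \<longleftrightarrow>
     height w = n \<and> width w = n \<and> (\<forall>k\<le>length w. width (take k w) \<le> height (take k w))"

definition phi :: "'a step list \<Rightarrow> 'a list" where
  "phi w = map label (filter is_north w)"

text \<open>
  Here \<open>permutations_of_set {1..n}\<close> is the set of distinct lists with set of elements \<open>{1..n}\<close>, that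
  is, of permutations in one-line notation. That \<open>phi w\<close> is one of them says that the north steps of
  \<open>w\<close> are labeled bijectively by \<open>{1..n}\<close>.
\<close>

definition parking_functions :: "nat \<Rightarrow> nat step list set" where
  "parking_functions n =
     {w. dyck_path n w \<and> phi w \<in> permutations_of_set {1..n} \<and>
         (\<forall>i. Suc i < length w \<longrightarrow> is_north (w ! i) \<longrightarrow> is_north (w ! Suc i) \<longrightarrow>
              label (w ! i) < label (w ! Suc i))}"

text \<open>Positions in one-line notation are counted from 0, as for all lists.\<close>

definition contains_pattern :: "nat list \<Rightarrow> nat list \<Rightarrow> bool" where
  "contains_pattern \<pi> \<rho> \<longleftrightarrow>
     (\<exists>i. strict_mono_on {..<length \<rho>} i \<and> i ` {..<length \<rho>} \<subseteq> {..<length \<pi>} \<and>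
          (\<forall>a<length \<rho>. \<forall>b<length \<rho>. \<pi> ! i a \<le> \<pi> ! i b \<longleftrightarrow> \<rho> ! a \<le> \<rho> ! b))"

definition avoids :: "nat list \<Rightarrow> nat list \<Rightarrow> bool" where
  "avoids \<pi> \<rho> \<longleftrightarrow> \<not> contains_pattern \<pi> \<rho>"

definition pf :: "nat \<Rightarrow> nat list set \<Rightarrow> nat" where
  "pf n R = card {p \<in> parking_functions n. \<forall>\<rho>\<in>R. avoids (phi p) \<rho>}"

definition catalan :: "nat \<Rightarrow> real" where
  "catalan k = 1 / (real k + 1) * real ((2 * k) choose k)"

end

theory Submission
  imports Defs
begin

text \<open>
  The number of parking functions \<open>p\<close> with \<open>phi p = \<pi>\<close> depends only on the descents of \<open>\<pi>\<close>: an east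
  step has to separate two north steps exactly where \<open>\<pi>\<close> descends. In a list avoiding 213, 231 and
  312 the first entry is either the minimum or the start of a decreasing list, so the avoiders are
  the \<open>n\<close> lists that rise \<open>k\<close> times (\<open>k < n\<close>), along the smallest entries and then to \<open>n\<close>, and fall
  afterwards. Reversal turns \<open>{213, 231, 312}\<close> into \<open>{132, 213, 312}\<close>, whose avoiders therefore
  have the same descent sets. Removing the first step of a path, for paths starting at an arbitrary
  height above the diagonal, gives a recursion for the total count with a closed form in ballot
  numbers.
\<close>

section \<open>Lists that first rise and then fall\<close>

definition rises_before :: "nat \<Rightarrow> nat list \<Rightarrow> bool" where
  "rises_before k xs \<longleftrightarrow> (\<forall>i. Suc i < length xs \<longrightarrow> (xs ! i < xs ! Suc i \<longleftrightarrow> i < k))"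

lemma rises_before_Cons_Suc:
  assumes "rises_before (Suc k) (x # xs)"
  shows "rises_before k xs" and "xs \<noteq> [] \<Longrightarrow> x < hd xs"
proof -
  show "rises_before k xs"
    unfolding rises_before_def
  proof (intro allI impI)
    fix i assume "Suc i < length xs"
    then show "xs ! i < xs ! Suc i \<longleftrightarrow> i < k"
      using assms[unfolded rises_before_def, rule_format, of "Suc i"] by simp
  qed
  show "x < hd xs" if "xs \<noteq> []"
    using assms[unfolded rises_before_def, rule_format, of 0] that by (simp add: hd_conv_nth)
qed

lemma rises_before_Cons_0:
  assumes "rises_before 0 (x # xs)"
  shows "rises_before 0 xs" and "xs \<noteq> [] \<Longrightarrow> \<not> x < hd xs"
proof -
  show "rises_before 0 xs"
    unfolding rises_before_def
  proof (intro allI impI)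
    fix i assume "Suc i < length xs"
    then show "xs ! i < xs ! Suc i \<longleftrightarrow> i < 0"
      using assms[unfolded rises_before_def, rule_format, of "Suc i"] by simp
  qed
  show "\<not> x < hd xs" if "xs \<noteq> []"
    using assms[unfolded rises_before_def, rule_format, of 0] that by (simp add: hd_conv_nth)
qed

section \<open>Counting labeled paths by removing the first step\<close>

text \<open>Paths start \<open>h\<close> above the diagonal and end on it. General \<open>h\<close>
  is what makes the family closed under removal of the first step.\<close>

definition labeled_paths :: "nat \<Rightarrow> nat list \<Rightarrow> nat step list set" where
  "labeled_paths h ls =
     {w. phi w = ls \<and> width w = height w + h \<and>
         (\<forall>k\<le>length w. width (take k w) \<le> height (take k w) + h) \<and>
         successively (\<lambda>a b. is_north a \<longrightarrow> is_north b \<longrightarrow> label a < label b) w}"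

text \<open>All that the rest of a path has to remember about a removed north step labeled
  \<open>l\<close>.\<close>

definition may_follow :: "nat \<Rightarrow> nat step list \<Rightarrow> bool" where
  "may_follow l w \<longleftrightarrow> (w \<noteq> [] \<longrightarrow> is_north (hd w) \<longrightarrow> l < label (hd w))"

lemma all_le_Suc: "(\<forall>k\<le>Suc n. P k) \<longleftrightarrow> P 0 \<and> (\<forall>k\<le>n. P (Suc k))"
  by (metis Suc_le_mono le0 not0_implies_Suc)

lemma Nil_in_labeled_paths: "[] \<in> labeled_paths h ls \<longleftrightarrow> h = 0 \<and> ls = []"
  by (auto simp: labeled_paths_def phi_def height_def width_def)

lemma East_in_labeled_paths:
  "East # w \<in> labeled_paths h ls \<longleftrightarrow> (\<exists>h'. h = Suc h' \<and> w \<in> labeled_paths h' ls)"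
proof (cases h)
  case 0
  then show ?thesis
    by (auto simp: labeled_paths_def phi_def height_def width_def all_le_Suc)
next
  case (Suc h')
  then show ?thesis
    by (auto simp: labeled_paths_def phi_def height_def width_def all_le_Suc successively_Cons)
qed

lemma North_in_labeled_paths:
  "North l # w \<in> labeled_paths h ls \<longleftrightarrow>
     (\<exists>ls'. ls = l # ls' \<and> w \<in> labeled_paths (Suc h) ls' \<and> may_follow l w)"
  by (cases ls) (auto simp: labeled_paths_def phi_def height_def width_def all_le_Suc
      successively_Cons may_follow_def)

text \<open>Needed for \<open>card\<close> to be additive: the length is forced and the steps come
  from a finite set.\<close>

lemma finite_labeled_paths: "finite (labeled_paths h ls)"
proof (rule finite_subset)
  show "labeled_paths h ls \<subseteq>
    {w. set w \<subseteq> insert East (North ` set ls) \<and> length w = 2 * length ls + h}"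
  proof (rule subsetI, rule CollectI)
    fix w assume w: "w \<in> labeled_paths h ls"
    have "length (filter is_north w) + length (filter is_east w) = length w"
      by (induction w) (auto simp: step.disc_eq_case split: step.splits)
    with w have "length w = 2 * length ls + h"
      by (auto simp: labeled_paths_def phi_def height_def width_def)
    moreover have "set w \<subseteq> insert East (North ` set (phi w))"
    proof
      fix s assume s: "s \<in> set w"
      show "s \<in> insert East (North ` set (phi w))"
      proof (cases s)
        case (North l)
        then have "s \<in> set (filter is_north w)" using s by simp
        then have "label s \<in> set (phi w)" unfolding phi_def set_map by (rule imageI)
        then show ?thesis using North by simp
      qed simp
    qed
    moreover have "phi w = ls" using w by (simp add: labeled_paths_def)
    ultimately show "set w \<subseteq> insert East (North ` set ls) \<and> length w = 2 * length ls + h"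
      by simp
  qed
qed (simp add: finite_lists_length_eq)

lemma labeled_paths_Nil: "labeled_paths h [] = {replicate h East}"
proof -
  have "w \<in> labeled_paths h [] \<longleftrightarrow> w = replicate h East" for w
  proof (induction w arbitrary: h)
    case Nil
    then show ?case by (cases h) (auto simp: Nil_in_labeled_paths)
  next
    case (Cons s w)
    then show ?case
      by (cases h; cases s) (auto simp: East_in_labeled_paths North_in_labeled_paths)
  qed
  then show ?thesis by blast
qed

text \<open>Before an ascent nothing is restricted. Otherwise a north step is excluded, and since
  the path is still \<open>Suc h\<close> above its end, it is nonempty and must go east.\<close>

lemma labeled_paths_may_follow:
  "{w \<in> labeled_paths (Suc h) ls. may_follow l w} =
     (if ls \<noteq> [] \<and> l < hd ls then labeled_paths (Suc h) ls else (#) East ` labeled_paths h ls)"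
  (is "?A = ?B")
proof -
  have "w \<in> ?A \<longleftrightarrow> w \<in> ?B" for w
  proof (cases w)
    case (Cons s v)
    then show ?thesis
      by (cases s) (auto simp: East_in_labeled_paths North_in_labeled_paths may_follow_def)
  qed (auto simp: Nil_in_labeled_paths)
  then show ?thesis by blast
qed

lemma labeled_paths_0_Cons:
  "labeled_paths 0 (l # ls) = (#) (North l) ` {w \<in> labeled_paths 1 ls. may_follow l w}"
  (is "?A = ?B")
proof -
  have "w \<in> ?A \<longleftrightarrow> w \<in> ?B" for w
  proof (cases w)
    case (Cons s v)
    then show ?thesis
      by (cases s) (auto simp: East_in_labeled_paths North_in_labeled_paths)
  qed (auto simp: Nil_in_labeled_paths)
  then show ?thesis by blast
qed

lemma labeled_paths_Suc_Cons:
  "labeled_paths (Suc h) (l # ls) = (#) East ` labeled_paths h (l # ls) \<union>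
     (#) (North l) ` {w \<in> labeled_paths (Suc (Suc h)) ls. may_follow l w}"
  (is "?A = ?B")
proof -
  have "w \<in> ?A \<longleftrightarrow> w \<in> ?B" for w
  proof (cases w)
    case (Cons s v)
    then show ?thesis
      by (cases s) (auto simp: East_in_labeled_paths North_in_labeled_paths)
  qed (auto simp: Nil_in_labeled_paths)
  then show ?thesis by blast
qed

text \<open>On the diagonal the first step is north. An ascent keeps the height it gains; a descent,
  or the end of the labels, forces an east step that loses it again.\<close>

lemma card_labeled_paths_0_Cons:
  "card (labeled_paths 0 (l # ls)) =
     card (labeled_paths (if ls \<noteq> [] \<and> l < hd ls then 1 else 0) ls)"
  by (simp add: labeled_paths_0_Cons labeled_paths_may_follow card_image)

lemma card_labeled_paths_Suc_Cons:
  "card (labeled_paths (Suc h) (l # ls)) = card (labeled_paths h (l # ls)) +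
     card (labeled_paths (if ls \<noteq> [] \<and> l < hd ls then Suc (Suc h) else Suc h) ls)"
  unfolding labeled_paths_Suc_Cons
  by (subst card_Un_disjoint)
     (auto simp: finite_labeled_paths labeled_paths_may_follow card_image)

text \<open>Each north step is followed by an east step, so such a path is a free arrangement of
  \<open>length ls\<close> north-east pairs and \<open>h\<close> further east steps. The recursions
  for \<open>card\<close> become Pascal's rule.\<close>

lemma card_labeled_paths_falling:
  assumes "rises_before 0 ls"
  shows "card (labeled_paths h ls) = (h + length ls) choose length ls"
  using assms
proof (induction ls arbitrary: h)
  case Nil
  then show ?case by (simp add: labeled_paths_Nil)
next
  case (Cons l ls)
  note r = rises_before_Cons_0[OF Cons.prems]
  note IH = Cons.IH[OF r(1)]
  show ?case
  proof (induction h)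
    case 0
    then show ?case using r(2) by (auto simp: card_labeled_paths_0_Cons IH)
  next
    case (Suc h)
    then show ?case using r(2) by (auto simp: card_labeled_paths_Suc_Cons IH)
  qed
qed

section \<open>Ballot numbers and the total count\<close>

text \<open>By the reflection principle, the number of unlabeled paths with \<open>r\<close> north
  steps from height \<open>h\<close> down to the diagonal; also the coefficient of
  \<open>x^r\<close> in the power \<open>h + 1\<close> of the Catalan series. The case
  \<open>r = 0\<close> is separate because \<open>r - 1\<close> would truncate to 0.\<close>

definition ballot :: "nat \<Rightarrow> nat \<Rightarrow> int" where
  "ballot h r = int ((2 * r + h) choose r) - (if r = 0 then 0 else int ((2 * r + h) choose (r - 1)))"

lemma ballot_0_Suc: "ballot 0 (Suc r) = ballot 1 r"
proof -
  have "Suc (2 * r) choose Suc r = Suc (2 * r) choose r"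
    using binomial_symmetric[of "Suc r" "Suc (2 * r)"] by simp
  then show ?thesis
    by (cases r) (auto simp: ballot_def)
qed

text \<open>The two summands correspond to a first step east or north; algebraically this is
  Pascal's rule.\<close>

lemma ballot_Suc_Suc: "ballot (Suc h) (Suc r) = ballot h (Suc r) + ballot (Suc (Suc h)) r"
  by (cases r) (auto simp: ballot_def)

text \<open>
  The closed form comes from generating functions: with \<open>C = 1 + x C\<^sup>2\<close>, the sums over \<open>k\<close> have
  the generating function \<open>((1 - x) C\<^bsup>h + 1\<^esup> - (1 - x)\<^bsup>- h\<^esup>) / x\<close> in the number of labels.
\<close>

lemma sum_card_labeled_paths:
  assumes "\<And>k. k < r \<Longrightarrow> length (L k) = r \<and> rises_before k (L k)"
  shows "(\<Sum>k<r. int (card (labeled_paths h (L k)))) =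
           ballot h (Suc r) - ballot h r - int ((h + r) choose Suc r)"
  using assms
proof (induction r arbitrary: L h)
  case 0
  then show ?case by (simp add: ballot_def)
next
  case (Suc q)
  \<comment> \<open>Without its first label, \<open>L (Suc k)\<close> rises \<open>k\<close> times,
    so \<open>M (Suc k)\<close> for \<open>k < q\<close> is again a family of the required kind.
    Only the falling list \<open>L 0\<close> falls outside it and is counted by a binomial
    coefficient.\<close>
  define M where "M k = tl (L k)" for k
  have L: "L k = hd (L k) # M k" if "k < Suc q" for k
    using Suc.prems[OF that] unfolding M_def by (cases "L k") auto
  have len: "length (M k) = q" if "k < Suc q" for k
    using Suc.prems[OF that] by (simp add: M_def)
  have M0: "rises_before 0 (M 0)" "M 0 \<noteq> [] \<Longrightarrow> \<not> hd (L 0) < hd (M 0)"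
    using rises_before_Cons_0[of "hd (L 0)" "M 0"] Suc.prems[of 0] L[of 0] by auto
  have MS: "rises_before k (M (Suc k))" "M (Suc k) \<noteq> [] \<and> hd (L (Suc k)) < hd (M (Suc k))"
    if "k < q" for k
  proof -
    have "rises_before (Suc k) (hd (L (Suc k)) # M (Suc k))"
      using Suc.prems[of "Suc k"] L[of "Suc k"] that by simp
    moreover have "M (Suc k) \<noteq> []" using len[of "Suc k"] that by auto
    ultimately show "rises_before k (M (Suc k))"
      "M (Suc k) \<noteq> [] \<and> hd (L (Suc k)) < hd (M (Suc k))"
      using rises_before_Cons_Suc by blast+
  qed
  have IH: "(\<Sum>k<q. int (card (labeled_paths j (M (Suc k))))) =
      ballot j (Suc q) - ballot j q - int ((j + q) choose Suc q)" for j
    by (rule Suc.IH) (use MS len in auto)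
  show ?case
  proof (induction h)
    case 0
    \<comment> \<open>This 1 cancels \<open>(1 + q) choose Suc q\<close> from \<open>IH\<close> at
      height 1.\<close>
    have "card (labeled_paths 0 (L 0)) = 1"
      using M0 len[of 0] by (subst L) (auto simp: card_labeled_paths_0_Cons card_labeled_paths_falling)
    moreover have "card (labeled_paths 0 (L (Suc k))) = card (labeled_paths 1 (M (Suc k)))"
      if "k < q" for k
      using MS[OF that] that by (subst L) (auto simp: card_labeled_paths_0_Cons)
    ultimately show ?case
      by (simp add: sum.lessThan_Suc_shift IH ballot_0_Suc del: sum.lessThan_Suc)
  next
    case (Suc h)
    have "card (labeled_paths (Suc h) (L 0)) =
        card (labeled_paths h (L 0)) + ((Suc h + q) choose q)"
      using M0 len[of 0]
      by (subst (1 2) L) (auto simp: card_labeled_paths_Suc_Cons card_labeled_paths_falling)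
    moreover have "card (labeled_paths (Suc h) (L (Suc k))) =
        card (labeled_paths h (L (Suc k))) + card (labeled_paths (Suc (Suc h)) (M (Suc k)))"
      if "k < q" for k
      using MS[OF that] that by (subst (1 2) L) (auto simp: card_labeled_paths_Suc_Cons)
    ultimately have "(\<Sum>k<Suc q. int (card (labeled_paths (Suc h) (L k)))) =
        (\<Sum>k<Suc q. int (card (labeled_paths h (L k)))) + int ((Suc h + q) choose q) +
        (\<Sum>k<q. int (card (labeled_paths (Suc (Suc h)) (M (Suc k)))))"
      by (simp add: sum.lessThan_Suc_shift sum.distrib del: sum.lessThan_Suc)
    \<comment> \<open>The ballot terms combine by their recursion. Pascal's rule, used twice,
      cancels \<open>(Suc h + q) choose q\<close> and merges the other two binomials.\<close>
    also have "\<dots> = ballot (Suc h) (Suc (Suc q)) - ballot (Suc h) (Suc q) -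
        int ((Suc h + Suc q) choose Suc (Suc q))"
      unfolding Suc.IH IH by (simp add: ballot_Suc_Suc)
    finally show ?case .
  qed
qed

lemma catalan_eq_ballot: "catalan n = real_of_int (ballot 0 n)"
proof (cases n)
  case 0
  then show ?thesis by (simp add: catalan_def ballot_def)
next
  case (Suc m)
  \<comment> \<open>Absorption gives the ratio of the two binomials in \<open>ballot 0 n\<close>;
    here \<open>2 * n - m = m + 2\<close>.\<close>
  have "Suc m * ((2 * n) choose Suc m) = (2 * n - m) * ((2 * n) choose m)"
    by (metis binomial_absorb_comp binomial_absorption mult.commute)
  then have "real (Suc m * ((2 * n) choose Suc m)) = real ((m + 2) * ((2 * n) choose m))"
    using Suc by simp
  then have "real n * real ((2 * n) choose n) = (real n + 1) * real ((2 * n) choose m)"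
    using Suc by (simp add: algebra_simps)
  then show ?thesis
    using Suc by (simp add: catalan_def ballot_def field_simps)
qed

section \<open>Patterns of length three and reversal\<close>

lemma contains_pattern_3:
  "contains_pattern \<pi> [a, b, c] \<longleftrightarrow>
     (\<exists>i j k. i < j \<and> j < k \<and> k < length \<pi> \<and>
       (\<pi> ! i \<le> \<pi> ! j \<longleftrightarrow> a \<le> b) \<and> (\<pi> ! j \<le> \<pi> ! i \<longleftrightarrow> b \<le> a) \<and>
       (\<pi> ! i \<le> \<pi> ! k \<longleftrightarrow> a \<le> c) \<and> (\<pi> ! k \<le> \<pi> ! i \<longleftrightarrow> c \<le> a) \<and>
       (\<pi> ! j \<le> \<pi> ! k \<longleftrightarrow> b \<le> c) \<and> (\<pi> ! k \<le> \<pi> ! j \<longleftrightarrow> c \<le> b))"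
  (is "?L \<longleftrightarrow> (\<exists>i j k. ?P i j k)")
proof
  have three: "{..<length [a, b, c]} = {0, 1, 2}" by auto
  {
    assume ?L
    then obtain f where "strict_mono_on {..<length [a, b, c]} f"
      "f ` {..<length [a, b, c]} \<subseteq> {..<length \<pi>}"
      and *: "\<forall>x<length [a, b, c]. \<forall>y<length [a, b, c]. \<pi> ! f x \<le> \<pi> ! f y \<longleftrightarrow> [a, b, c] ! x \<le> [a, b, c] ! y"
      unfolding contains_pattern_def by blast
    then have "f 0 < f 1" "f 1 < f 2" "f 2 < length \<pi>"
      unfolding three by (auto simp: strict_mono_on_def)
    then have "?P (f 0) (f 1) (f 2)"
      using *[rule_format, of 0 1] *[rule_format, of 1 0] *[rule_format, of 0 2]
        *[rule_format, of 2 0] *[rule_format, of 1 2] *[rule_format, of 2 1] by simp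
    then show "\<exists>i j k. ?P i j k" by blast
  next
    assume "\<exists>i j k. ?P i j k"
    then obtain i j k where P: "?P i j k" by blast
    define f where "f = (!) [i, j, k]"
    have "\<forall>x<3. \<forall>y<3. \<pi> ! f x \<le> \<pi> ! f y \<longleftrightarrow> [a, b, c] ! x \<le> [a, b, c] ! y"
      using P by (simp add: f_def All_less_Suc numeral_3_eq_3)
    moreover have "strict_mono_on {0, 1, 2} f"
      using P by (auto simp: strict_mono_on_def f_def)
    moreover have "f ` {0, 1, 2} \<subseteq> {..<length \<pi>}"
      using P by (auto simp: f_def)
    ultimately show ?L
      unfolding contains_pattern_def three by (intro exI[of _ f]) auto
  }
qed

lemma contains_pattern_3_rev:
  "contains_pattern (rev \<pi>) [a, b, c] \<longleftrightarrow> contains_pattern \<pi> [c, b, a]"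
proof -
  have imp: "contains_pattern (rev \<pi>) [c, b, a]" if "contains_pattern \<pi> [a, b, c]" for \<pi> a b c
  proof -
    obtain i j k where ijk: "i < j" "j < k" "k < length \<pi>" and
      P: "(\<pi> ! i \<le> \<pi> ! j \<longleftrightarrow> a \<le> b) \<and> (\<pi> ! j \<le> \<pi> ! i \<longleftrightarrow> b \<le> a) \<and>
       (\<pi> ! i \<le> \<pi> ! k \<longleftrightarrow> a \<le> c) \<and> (\<pi> ! k \<le> \<pi> ! i \<longleftrightarrow> c \<le> a) \<and>
       (\<pi> ! j \<le> \<pi> ! k \<longleftrightarrow> b \<le> c) \<and> (\<pi> ! k \<le> \<pi> ! j \<longleftrightarrow> c \<le> b)"
      using \<open>contains_pattern \<pi> [a, b, c]\<close> unfolding contains_pattern_3 by blast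
    show ?thesis
      unfolding contains_pattern_3
      \<comment> \<open>The mirror images of the three positions, in reversed order.\<close>
      by (rule exI[of _ "length \<pi> - Suc k"], rule exI[of _ "length \<pi> - Suc j"],
          rule exI[of _ "length \<pi> - Suc i"])
         (use ijk P in \<open>auto simp: rev_nth\<close>)
  qed
  show ?thesis
    using imp[of "rev \<pi>" a b c] imp[of \<pi> c b a] by auto
qed

section \<open>The permutations avoiding 213, 231 and 312\<close>

text \<open>For distinct entries this leaves the orders 123, 132 and 321, the complement of the
  three forbidden ones.\<close>

definition min_first_or_falling :: "nat \<Rightarrow> nat \<Rightarrow> nat \<Rightarrow> bool" where
  "min_first_or_falling x y z \<longleftrightarrow> x < y \<and> x < z \<or> x > y \<and> y > z"

text \<open>The recursion isolates the triples that begin with the first entry;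
  \<open>sorted_wrt\<close> ranges over all pairs of later positions, not only adjacent
  ones.\<close>

fun good_triples :: "nat list \<Rightarrow> bool" where
  "good_triples [] \<longleftrightarrow> True"
| "good_triples (x # xs) \<longleftrightarrow> good_triples xs \<and> sorted_wrt (min_first_or_falling x) xs"

lemma good_triples_iff:
  "good_triples xs \<longleftrightarrow> (\<forall>i j k. i < j \<longrightarrow> j < k \<longrightarrow> k < length xs \<longrightarrow>
     min_first_or_falling (xs ! i) (xs ! j) (xs ! k))"
proof (induction xs)
  case (Cons x xs)
  let ?Q = min_first_or_falling
  have "(\<forall>i j k. i < j \<longrightarrow> j < k \<longrightarrow> k < length (x # xs) \<longrightarrow> ?Q ((x # xs) ! i) ((x # xs) ! j) ((x # xs) ! k))
    \<longleftrightarrow> (\<forall>i j k. i < j \<longrightarrow> j < k \<longrightarrow> k < length xs \<longrightarrow> ?Q (xs ! i) (xs ! j) (xs ! k)) \<and>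
        (\<forall>j k. j < k \<longrightarrow> k < length xs \<longrightarrow> ?Q x (xs ! j) (xs ! k))"
    (is "?L \<longleftrightarrow> ?R1 \<and> ?R2")
  proof (intro iffI conjI)
    assume L: ?L
    show ?R1
    proof (intro allI impI)
      fix i j k assume "i < j" "j < k" "k < length xs"
      then show "?Q (xs ! i) (xs ! j) (xs ! k)"
        using L[rule_format, of "Suc i" "Suc j" "Suc k"] by simp
    qed
    show ?R2
    proof (intro allI impI)
      fix j k assume "j < k" "k < length xs"
      then show "?Q x (xs ! j) (xs ! k)" using L[rule_format, of 0 "Suc j" "Suc k"] by simp
    qed
  next
    assume R: "?R1 \<and> ?R2"
    show ?L
    proof (intro allI impI)
      fix i j k assume *: "i < j" "j < k" "k < length (x # xs)"
      then obtain j' k' where jk: "j = Suc j'" "k = Suc k'"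
        by (metis less_nat_zero_code not0_implies_Suc)
      show "?Q ((x # xs) ! i) ((x # xs) ! j) ((x # xs) ! k)"
        using R * jk by (cases i) auto
    qed
  qed
  then show ?case
    unfolding good_triples.simps Cons.IH sorted_wrt_iff_nth_less by blast
qed simp

lemma avoids_iff_good_triples:
  assumes "distinct xs"
  shows "(\<forall>\<rho>\<in>{[2,1,3], [2,3,1], [3,1,2]}. avoids xs \<rho>) \<longleftrightarrow> good_triples xs"
proof -
  have triple: "min_first_or_falling (xs ! i) (xs ! j) (xs ! k) \<longleftrightarrow>
      \<not> (xs ! j < xs ! i \<and> xs ! i < xs ! k) \<and> \<not> (xs ! k < xs ! i \<and> xs ! i < xs ! j) \<and>
      \<not> (xs ! j < xs ! k \<and> xs ! k < xs ! i)"
    if "i < j" "j < k" "k < length xs" for i j k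
  proof -
    have "xs ! i \<noteq> xs ! j" "xs ! i \<noteq> xs ! k" "xs ! j \<noteq> xs ! k"
      using assms that by (simp_all add: nth_eq_iff_index_eq)
    then show ?thesis unfolding min_first_or_falling_def by linarith
  qed
  have c: "contains_pattern xs [2,1,3] \<longleftrightarrow>
      (\<exists>i j k. i < j \<and> j < k \<and> k < length xs \<and> xs ! j < xs ! i \<and> xs ! i < xs ! k)"
    "contains_pattern xs [2,3,1] \<longleftrightarrow>
      (\<exists>i j k. i < j \<and> j < k \<and> k < length xs \<and> xs ! k < xs ! i \<and> xs ! i < xs ! j)"
    "contains_pattern xs [3,1,2] \<longleftrightarrow>
      (\<exists>i j k. i < j \<and> j < k \<and> k < length xs \<and> xs ! j < xs ! k \<and> xs ! k < xs ! i)"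
    unfolding contains_pattern_3 by (intro ex_cong1; auto)+
  have gt: "good_triples xs \<longleftrightarrow> (\<forall>i j k. i < j \<longrightarrow> j < k \<longrightarrow> k < length xs \<longrightarrow>
      \<not> (xs ! j < xs ! i \<and> xs ! i < xs ! k) \<and> \<not> (xs ! k < xs ! i \<and> xs ! i < xs ! j) \<and>
      \<not> (xs ! j < xs ! k \<and> xs ! k < xs ! i))"
    unfolding good_triples_iff by (intro iff_allI imp_cong refl triple)
  have "(\<forall>\<rho>\<in>{[2,1,3], [2,3,1], [3,1,2]}. avoids xs \<rho>) \<longleftrightarrow>
    \<not> contains_pattern xs [2,1,3] \<and> \<not> contains_pattern xs [2,3,1] \<and> \<not> contains_pattern xs [3,1,2]"
    by (simp add: avoids_def)
  also have "\<dots> \<longleftrightarrow> good_triples xs"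
    unfolding c gt by blast
  finally show ?thesis .
qed

definition peak_list :: "nat \<Rightarrow> nat list \<Rightarrow> nat list" where
  "peak_list m s = take m s @ rev (drop m s)"

lemma good_triples_falling:
  assumes "sorted_wrt (>) xs"
  shows "good_triples xs"
  using assms
  unfolding good_triples_iff min_first_or_falling_def sorted_wrt_iff_nth_less by simp

text \<open>While \<open>m\<close> is positive the first entry is the minimum, so all triples
  beginning there are good; at \<open>m = 0\<close> the whole list falls.\<close>

lemma good_triples_peak_list:
  assumes "sorted_wrt (<) s"
  shows "good_triples (peak_list m s)"
  using assms
proof (induction s arbitrary: m)
  case Nil
  then show ?case by (simp add: peak_list_def)
next
  case (Cons x s)
  show ?case
  proof (cases m)
    case 0
    then show ?thesis
      using Cons.prems by (auto simp: peak_list_def sorted_wrt_rev sorted_wrt_append intro!: good_triples_falling)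
  next
    case (Suc m')
    have "\<forall>y \<in> set (peak_list m' s). x < y"
      using Cons.prems by (auto simp: peak_list_def dest: in_set_takeD in_set_dropD)
    then have "sorted_wrt (min_first_or_falling x) (peak_list m' s)"
      by (simp add: sorted_wrt_iff_nth_less min_first_or_falling_def)
    then show ?thesis
      using Cons.IH[of m'] Cons.prems Suc by (simp add: peak_list_def)
  qed
qed

text \<open>A minimal first entry is stripped and \<open>m\<close> grows by one. Otherwise a single
  entry below \<open>x\<close> forces the whole list to fall, and \<open>m = 0\<close>.\<close>

lemma good_triples_imp_peak_list:
  assumes "distinct xs" "good_triples xs"
  shows "\<exists>m. xs = peak_list m (sorted_list_of_set (set xs))"
  using assms
proof (induction xs)
  case Nil
  then show ?case by (simp add: peak_list_def)
next
  case (Cons x xs)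
  have sw: "min_first_or_falling x (xs ! j) (xs ! k)" if "j < k" "k < length xs" for j k
    using Cons.prems that by (simp add: sorted_wrt_iff_nth_less)
  show ?case
  proof (cases "\<forall>y\<in>set xs. x < y")
    case True
    obtain m where m: "xs = peak_list m (sorted_list_of_set (set xs))"
      using Cons by auto
    have "sorted_list_of_set (set (x # xs)) = x # sorted_list_of_set (set xs)"
      using True Cons.prems
      by (intro sorted_list_of_set_unique[THEN iffD1]) (auto simp: distinct_card)
    then have "x # xs = peak_list (Suc m) (sorted_list_of_set (set (x # xs)))"
      using m by (simp add: peak_list_def)
    then show ?thesis by blast
  next
    case False
    then obtain i where i: "i < length xs" "xs ! i < x"
      using Cons.prems by (metis distinct.simps(2) in_set_conv_nth linorder_neqE_nat)
    \<comment> \<open>In the triple of \<open>x\<close> with positions \<open>i\<close> and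
      \<open>j\<close>, the entry at \<open>i\<close> rules out that \<open>x\<close> is the
      minimum, so the triple falls.\<close>
    have below: "xs ! j < x" if "j < length xs" for j
    proof (cases i j rule: linorder_cases)
      case less
      then show ?thesis using sw[of i j] i that by (auto simp: min_first_or_falling_def)
    next
      case greater
      then show ?thesis using sw[of j i] i by (auto simp: min_first_or_falling_def)
    qed (use i in simp)
    have "sorted_wrt (>) (x # xs)"
      unfolding sorted_wrt.simps
    proof
      show "\<forall>y\<in>set xs. y < x" using below by (auto simp: in_set_conv_nth)
      show "sorted_wrt (>) xs"
        unfolding sorted_wrt_iff_nth_less
      proof (intro allI impI)
        fix j k assume jk: "j < k" "k < length xs"
        then show "xs ! j > xs ! k"
          using sw[of j k] below[of j] by (auto simp: min_first_or_falling_def)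
      qed
    qed
    then have "sorted_wrt (<) (rev (x # xs))" unfolding sorted_wrt_rev by simp
    then have "sorted_list_of_set (set (rev (x # xs))) = rev (x # xs)"
      by (intro sorted_list_of_set_unique[THEN iffD1]) (use Cons.prems in \<open>auto simp: distinct_card\<close>)
    then have "x # xs = peak_list 0 (sorted_list_of_set (set (x # xs)))"
      unfolding peak_list_def set_rev by simp
    then show ?thesis by blast
  qed
qed

lemma nth_peak_list_upt:
  assumes "m < n" "i < n"
  shows "peak_list m [1..<Suc n] ! i = (if i < m then Suc i else n + m - i)"
  using assms by (auto simp: peak_list_def nth_append rev_nth simp del: upt_Suc)

lemma length_peak_list [simp]: "length (peak_list m s) = length s"
  by (simp add: peak_list_def)

lemma peak_list_permutation: "peak_list m [1..<Suc n] \<in> permutations_of_set {1..n}"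
proof -
  have mset: "mset (peak_list m [1..<Suc n]) = mset [1..<Suc n]"
    unfolding peak_list_def by (metis append_take_drop_id mset_append mset_rev)
  have "set (peak_list m [1..<Suc n]) = {1..n}"
    using mset_eq_setD[OF mset] by auto
  moreover have "distinct (peak_list m [1..<Suc n])"
    using mset_eq_imp_distinct_iff[OF mset] by simp
  ultimately show ?thesis by (simp add: permutations_of_set_def)
qed

lemma avoiders_eq_peak_lists:
  assumes "n \<ge> 1"
  shows "{\<pi> \<in> permutations_of_set {1..n}. \<forall>\<rho>\<in>{[2,1,3], [2,3,1], [3,1,2]}. avoids \<pi> \<rho>} =
    (\<lambda>m. peak_list m [1..<Suc n]) ` {..<n}" (is "?A = ?B")
proof
  show "?B \<subseteq> ?A"
  proof
    fix \<pi> assume "\<pi> \<in> ?B"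
    then obtain m where \<pi>: "\<pi> = peak_list m [1..<Suc n]" by blast
    then have perm: "\<pi> \<in> permutations_of_set {1..n}" using peak_list_permutation by simp
    moreover have "good_triples \<pi>"
      unfolding \<pi> by (intro good_triples_peak_list sorted_wrt_upt)
    ultimately show "\<pi> \<in> ?A"
      using avoids_iff_good_triples permutations_of_setD(2) by blast
  qed
  show "?A \<subseteq> ?B"
  proof
    fix \<pi> assume \<pi>: "\<pi> \<in> ?A"
    then have *: "set \<pi> = {1..n}" "distinct \<pi>" by (auto dest: permutations_of_setD)
    have "good_triples \<pi>" using \<pi> avoids_iff_good_triples[OF *(2)] by simp
    moreover have "sorted_list_of_set {1..n} = [1..<Suc n]"
      by (metis atLeastLessThanSuc_atLeastAtMost sorted_list_of_set_range)
    ultimately obtain m where m: "\<pi> = peak_list m [1..<Suc n]"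
      using good_triples_imp_peak_list[OF *(2)] * by metis
    show "\<pi> \<in> ?B"
    proof (cases "m < n")
      case True
      then show ?thesis using m by blast
    next
      case False
      \<comment> \<open>For \<open>m \<ge> n\<close> the list is increasing, and so it is for
        \<open>m = n - 1\<close>, where a single entry is reversed.\<close>
      have "\<pi> = peak_list (n - 1) [1..<Suc n]"
        using False assms m by (cases n) (auto simp: peak_list_def)
      then show ?thesis using assms by auto
    qed
  qed
qed

lemma inj_on_peak_list: "inj_on (\<lambda>m. peak_list m [1..<Suc n]) {..<n}"
proof (rule linorder_inj_onI)
  fix m m' assume *: "m < m'" "m \<in> {..<n}" "m' \<in> {..<n}"
  \<comment> \<open>Position \<open>m\<close> holds the maximum \<open>n\<close> in the first list,
    but only \<open>m + 1 < n\<close> in the second.\<close>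
  then have "peak_list m [1..<Suc n] ! m \<noteq> peak_list m' [1..<Suc n] ! m"
    by (simp add: nth_peak_list_upt del: upt_Suc One_nat_def)
  then show "peak_list m [1..<Suc n] \<noteq> peak_list m' [1..<Suc n]" by metis
qed auto

lemma rises_before_peak_list:
  assumes "m < n"
  shows "rises_before m (peak_list m [1..<Suc n])"
  using assms by (auto simp: rises_before_def nth_peak_list_upt simp del: upt_Suc One_nat_def)

text \<open>The peak, at position \<open>m\<close>, moves to position
  \<open>n - 1 - m\<close>.\<close>

lemma rises_before_rev_peak_list:
  assumes "m < n"
  shows "rises_before (n - Suc m) (rev (peak_list m [1..<Suc n]))"
  using assms by (auto simp: rises_before_def rev_nth nth_peak_list_upt simp del: upt_Suc One_nat_def)

section \<open>From avoiders to parking functions\<close>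

lemma parking_functions_phi_eq:
  assumes "ls \<in> permutations_of_set {1..n}"
  shows "{p \<in> parking_functions n. phi p = ls} = labeled_paths 0 ls"
proof -
  have "length ls = n"
    using assms by (simp add: length_finite_permutations_of_set)
  then have "height p = n" if "phi p = ls" for p
    using that by (auto simp: phi_def height_def)
  then show ?thesis
    using assms
    by (auto simp: parking_functions_def labeled_paths_def dyck_path_def successively_conv_nth)
qed

text \<open>What both pattern sets share: one avoider for each number \<open>k < n\<close> of
  initial ascents. Parking functions are split by the value of \<open>phi\<close>.\<close>

lemma pf_eq_sum:
  assumes avoiders: "{\<pi> \<in> permutations_of_set {1..n}. \<forall>\<rho>\<in>R. avoids \<pi> \<rho>} = L ` {..<n}"
    and inj: "inj_on L {..<n}"
    and rises: "\<And>k. k < n \<Longrightarrow> rises_before k (L k)"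
  shows "real (pf n R) = catalan (n + 1) - catalan n"
proof -
  have perm: "L k \<in> permutations_of_set {1..n}" if "k < n" for k
    using avoiders that by blast
  then have len: "length (L k) = n" if "k < n" for k
    using length_finite_permutations_of_set[OF perm[OF that]] by simp
  have "{p \<in> parking_functions n. \<forall>\<rho>\<in>R. avoids (phi p) \<rho>} =
      (\<Union>k<n. {p \<in> parking_functions n. phi p = L k})"
  proof -
    have "phi p \<in> permutations_of_set {1..n}" if "p \<in> parking_functions n" for p
      using that by (simp add: parking_functions_def)
    then show ?thesis using avoiders by blast
  qed
  also have "\<dots> = (\<Union>k<n. labeled_paths 0 (L k))"
    using perm parking_functions_phi_eq by simp
  finally have "pf n R = card (\<Union>k<n. labeled_paths 0 (L k))"
    by (simp add: pf_def)
  also have "\<dots> = (\<Sum>k<n. card (labeled_paths 0 (L k)))"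
  proof (rule card_UN_disjoint)
    show "\<forall>i\<in>{..<n}. \<forall>j\<in>{..<n}. i \<noteq> j \<longrightarrow> labeled_paths 0 (L i) \<inter> labeled_paths 0 (L j) = {}"
      using inj by (auto simp: labeled_paths_def dest: inj_onD)
  qed (auto simp: finite_labeled_paths)
  finally have "int (pf n R) = (\<Sum>k<n. int (card (labeled_paths 0 (L k))))"
    by simp
  \<comment> \<open>At height 0 the correction term \<open>n choose Suc n\<close> vanishes.\<close>
  also have "\<dots> = ballot 0 (Suc n) - ballot 0 n"
    using sum_card_labeled_paths[of n L 0] rises len by simp
  finally show ?thesis
    unfolding catalan_eq_ballot by (metis Suc_eq_plus1 of_int_diff of_int_of_nat_eq)
qed

theorem theorem13:
  fixes n :: nat
  assumes "n \<ge> 1"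
  shows "real (pf n {[1,3,2], [2,1,3], [3,1,2]}) = catalan (n + 1) - catalan n
       \<and> real (pf n {[2,1,3], [2,3,1], [3,1,2]}) = catalan (n + 1) - catalan n"
proof
  let ?P = "\<lambda>m. peak_list m [1..<Suc n]"
  \<comment> \<open>The index is reflected so that the reversed list rises exactly \<open>k\<close>
    times.\<close>
  let ?L = "\<lambda>k. rev (?P (n - Suc k))"
  \<comment> \<open>Reversal sends 132 to 231 and exchanges 213 and 312.\<close>
  have rev_avoids: "(\<forall>\<rho>\<in>{[1,3,2], [2,1,3], [3,1,2]}. avoids (rev \<pi>) \<rho>) \<longleftrightarrow>
      (\<forall>\<rho>\<in>{[2,1,3], [2,3,1], [3,1,2]}. avoids \<pi> \<rho>)" for \<pi>
    by (auto simp: avoids_def contains_pattern_3_rev)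
  have rev_perm: "rev \<pi> \<in> permutations_of_set {1..n} \<longleftrightarrow> \<pi> \<in> permutations_of_set {1..n}" for \<pi>
    by (simp add: permutations_of_set_def)
  have "{\<pi> \<in> permutations_of_set {1..n}. \<forall>\<rho>\<in>{[1,3,2], [2,1,3], [3,1,2]}. avoids \<pi> \<rho>} =
      rev ` {\<pi> \<in> permutations_of_set {1..n}. \<forall>\<rho>\<in>{[2,1,3], [2,3,1], [3,1,2]}. avoids \<pi> \<rho>}"
    (is "?A = rev ` ?B")
  proof -
    have "\<pi> \<in> ?A \<longleftrightarrow> rev \<pi> \<in> ?B" for \<pi>
      using rev_avoids[of "rev \<pi>"] rev_perm[of \<pi>] by simp
    moreover have "\<pi> \<in> rev ` S \<longleftrightarrow> rev \<pi> \<in> S" for \<pi> :: "nat list" and S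
      by (metis image_iff rev_rev_ident)
    ultimately show ?thesis by (simp only: set_eq_iff simp_thms)
  qed
  also have "\<dots> = (\<lambda>m. rev (?P m)) ` {..<n}"
    unfolding avoiders_eq_peak_lists[OF assms] image_image ..
  also have "{..<n} = (\<lambda>k. n - Suc k) ` {..<n}"
  proof (intro subset_antisym subsetI)
    fix m assume "m \<in> {..<n}"
    then show "m \<in> (\<lambda>k. n - Suc k) ` {..<n}"
      by (intro image_eqI[of _ _ "n - Suc m"]) auto
  qed auto
  finally have avoiders: "?A = ?L ` {..<n}"
    by (simp add: image_image del: upt_Suc One_nat_def)
  show "real (pf n {[1,3,2], [2,1,3], [3,1,2]}) = catalan (n + 1) - catalan n"
  proof (rule pf_eq_sum[OF avoiders])
    show "inj_on ?L {..<n}"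
    proof (rule inj_onI)
      fix k k' assume *: "k \<in> {..<n}" "k' \<in> {..<n}" "?L k = ?L k'"
      then have "n - Suc k = n - Suc k'"
        by (intro inj_onD[OF inj_on_peak_list[of n]]) (auto simp del: upt_Suc One_nat_def)
      then show "k = k'" using * by auto
    qed
    show "rises_before k (?L k)" if "k < n" for k
      using rises_before_rev_peak_list[of "n - Suc k" n] that by (simp del: upt_Suc One_nat_def)
  qed
  show "real (pf n {[2,1,3], [2,3,1], [3,1,2]}) = catalan (n + 1) - catalan n"
    using avoiders_eq_peak_lists[OF assms] inj_on_peak_list rises_before_peak_list
    by (rule pf_eq_sum)
qed

end
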